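(* Let $(X,\tau_X)$ be a (non-empty) Polish space and $T:X\to X$ a $\tau_X$-continuous map. Assume that $X$ is endowed with a Hausdorff topology $\tau$ such that (I) $T$ is a continuous self-map of $(X,\tau)$; (II) $\tau\subset\tau_X$; (III* ) every point of $X$ has a neighbourhood basis for $\tau_X$ consisting of $\tau$-compact sets. If $x_0\in X$ is a reiteratively recurrent point for $T$ (with respect to $\tau_X$), then there is a $T$-invariant probability measure $\mu_{x_0}$ on $X$ such that $$x_0\in\operatorname{supp}(\mu_{x_0})\subset\overline{\operatorname{Orb}(x_0,T)}^{\tau}.$$ Moreover, if $T$ is reiteratively recurrent, then there is a $T$-invariant probability measure $\mu$ on $X$ with full support.
   Context: $\mathbb{N}_0=\{0,1,2,\dots\}$. $\operatorname{Orb}(x,T)=\{T^nx:n\in\mathbb{N}_0\}$ and $\overline{\,\cdot\,}^{\tau}$ denotes $\tau$-closure. $N(x,A)=\{n\in\mathbb{N}_0:T^nx\in A\}$. The upper Banach density of $A\subset\mathbb{N}_0$ is $\overline{\operatorname{Bd}}(A)=\limsup_{N\to\infty}\left(\max_{m\ge0}\frac{\operatorname{card}(A\cap[m,m+N])}{N+1}\right)$. A point $x\in X$ is reiteratively recurrent if $\overline{\operatorname{Bd}}(N(x,U))>0$ for every $\tau_X$-neighbourhood $U$ of $x$; $T$ is reiteratively recurrent if the set of such points is $\tau_X$-dense in $X$. Measures are Borel measures on $(X,\tau_X)$; $\mu$ is $T$-invariant if $\mu(T^{-1}(A))=\mu(A)$ for all Borel $A$. The support $\operatorname{supp}(\mu)$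 is taken with respect to $\tau_X$: it is the complement of the union of all $\tau_X$-open $\mu$-null sets, i.e. $x\in\operatorname{supp}(\mu)$ iff $\mu(U)>0$ for every $\tau_X$-neighbourhood $U$ of $x$. Full support means $\mu(U)>0$ for every non-empty $\tau_X$-open set $U$. *)

theory Defs
  imports "HOL-Probability.Probability"
begin

text \<open>
  The topology of the ambient type plays the role of the Polish topology; the second, coarser
  topology occurs in the theorem as a value of type \<^typ>\<open>'a topology\<close> with underlying set
  \<^term>\<open>UNIV\<close>.
\<close>

definition visit_times :: "('a \<Rightarrow> 'a) \<Rightarrow> 'a \<Rightarrow> 'a set \<Rightarrow> nat set" where
  "visit_times T x A = {n. (T ^^ n) x \<in> A}"

definition forward_orbit :: "('a \<Rightarrow> 'a) \<Rightarrow> 'a \<Rightarrow> 'a set" where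
  "forward_orbit T x = {(T ^^ n) x | n. True}"

definition upper_Banach_density :: "nat set \<Rightarrow> ereal" where
  "upper_Banach_density A =
     limsup (\<lambda>N. ereal (Max (range (\<lambda>m. real (card (A \<inter> {m..m + N})) / real (N + 1)))))"

text \<open>The maximum over all \<open>m\<close> is well defined, since only finitely many values occur:\<close>

lemma finite_range_window_density:
  "finite (range (\<lambda>m. real (card (A \<inter> {m..m + N})) / real (N + 1)))"
proof (rule finite_subset)
  show "range (\<lambda>m. real (card (A \<inter> {m..m + N})) / real (N + 1))
          \<subseteq> (\<lambda>k. real k / real (N + 1)) ` {..N + 1}"
  proof (rule image_subsetI)
    fix m
    have "card (A \<inter> {m..m + N}) \<le> card {m..m + N}"
      by (intro card_mono) auto
    then show "real (card (A \<inter> {m..m + N})) / real (N + 1)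
                 \<in> (\<lambda>k. real k / real (N + 1)) ` {..N + 1}"
      by (intro imageI) simp
  qed
qed simp

definition reiteratively_recurrent_point ::
    "('a::topological_space \<Rightarrow> 'a) \<Rightarrow> 'a \<Rightarrow> bool" where
  "reiteratively_recurrent_point T x \<longleftrightarrow>
     (\<forall>U. x \<in> interior U \<longrightarrow> upper_Banach_density (visit_times T x U) > 0)"

definition reiteratively_recurrent :: "('a::topological_space \<Rightarrow> 'a) \<Rightarrow> bool" where
  "reiteratively_recurrent T \<longleftrightarrow> closure {x. reiteratively_recurrent_point T x} = UNIV"

definition invariant_prob_measure ::
    "('a::topological_space \<Rightarrow> 'a) \<Rightarrow> 'a measure \<Rightarrow> bool" where
  "invariant_prob_measure T M \<longleftrightarrow>
     prob_space M \<and> sets M = sets borel \<and>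
     (\<forall>A \<in> sets borel. emeasure M (T -` A) = emeasure M A)"

definition measure_support :: "'a::topological_space measure \<Rightarrow> 'a set" where
  "measure_support M = - \<Union>{U. open U \<and> emeasure M U = 0}"

definition full_support :: "'a::topological_space measure \<Rightarrow> bool" where
  "full_support M \<longleftrightarrow> (\<forall>U. open U \<and> U \<noteq> {} \<longrightarrow> emeasure M U > 0)"

end

theory Submission
  imports Defs
begin

text \<open>
Suppose that the visits of \<open>x\<close> to a set \<open>K\<close> have positive upper Banach density. A generalised limit
of window densities is a finitely additive, shift-invariant mean \<open>m\<close> on sets of natural numbers that
is positive on these visit times (\<open>upper_Banach_density_pos_imp_mean\<close>). Then
\<open>q A = m {n. T\<^sup>n x \<in> A}\<close> is a finitely additive, \<open>T\<close>-invariant probability on all subsets of \<open>X\<close>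
with \<open>q K > 0\<close>. The difficulty is countable additivity, and here compactness for the coarser topology
\<open>\<tau>\<close> helps. The function \<open>L \<mapsto> inf {q U | U \<tau>-open, L \<subseteq> U}\<close> is a content on the \<open>\<tau>\<close>-compact sets, and
such a content induces a measure by Caratheodory's construction (locale \<open>compact_content\<close>). The
measure may have smaller total mass than \<open>q\<close>, but it is at least \<open>q K > 0\<close> on \<open>K\<close> if \<open>K\<close> is
\<open>\<tau>\<close>-compact.

Invariance follows from one inequality: \<open>T\<close> maps compact sets to compact sets, which gives
\<open>\<mu> (T\<^sup>-\<^sup>1 A) \<le> \<mu> A\<close> for all \<open>A\<close>, and a finite measure with this property is invariant, as one sees by
taking complements. The complement of the \<open>\<tau>\<close>-closure of the orbit is \<open>\<tau>\<close>-open and never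
visited, so it is a null set (\<open>invariant_measure_from_mean\<close>). The measure lives on the Borel sets of
\<open>\<tau>\<close>, which are those of the Polish topology since every open set is a countable union of
\<open>\<tau>\<close>-compact sets (\<open>borel_eq_sigma_coarser\<close>).

Hence every neighbourhood of a recurrent point is charged by some invariant probability measure that
is carried by the orbit closure. Countable mixtures
(\<open>countable_mixture_of_invariant_measures\<close>) then charge simultaneously all basic neighbourhoods of
one recurrent point, or, if recurrent points are dense, all non-empty basic open sets.
\<close>

section \<open>Shift-invariant means on the natural numbers\<close>

definition shift_invariant_mean :: "(nat set \<Rightarrow> real) \<Rightarrow> bool" where
  "shift_invariant_mean m \<longleftrightarrow>
     (\<forall>B. 0 \<le> m B) \<and> m UNIV = 1 \<and>
     (\<forall>B C. B \<inter> C = {} \<longrightarrow> m (B \<union> C) = m B + m C) \<and>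
     (\<forall>B. m (Suc -` B) = m B)"

lemma
  assumes "shift_invariant_mean m"
  shows shift_invariant_mean_nonneg: "0 \<le> m B"
    and shift_invariant_mean_UNIV: "m UNIV = 1"
    and shift_invariant_mean_Un_disjoint: "B \<inter> C = {} \<Longrightarrow> m (B \<union> C) = m B + m C"
    and shift_invariant_mean_vimage_Suc: "m (Suc -` B) = m B"
  using assms unfolding shift_invariant_mean_def by blast+

lemma shift_invariant_mean_empty: "shift_invariant_mean m \<Longrightarrow> m {} = 0"
  using shift_invariant_mean_Un_disjoint[of m "{}" "{}"] by simp

lemma shift_invariant_mean_Un_diff:
  "shift_invariant_mean m \<Longrightarrow> m (B \<union> C) = m B + m (C - B)"
  using shift_invariant_mean_Un_disjoint[of m B "C - B"] by simp

lemma shift_invariant_mean_mono: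
  "shift_invariant_mean m \<Longrightarrow> B \<subseteq> C \<Longrightarrow> m B \<le> m C"
  using shift_invariant_mean_Un_diff[of m B C] shift_invariant_mean_nonneg[of m "C - B"]
  by (simp add: Un_absorb1)

lemma shift_invariant_mean_Un_le:
  "shift_invariant_mean m \<Longrightarrow> m (B \<union> C) \<le> m B + m C"
  using shift_invariant_mean_Un_diff[of m B C] shift_invariant_mean_mono[of m "C - B" C] by simp

text \<open>
Generalised limits come from compactness: a cluster point \<open>l\<close> of the sequence in the Tychonoff
product of the intervals yields a filter finer than \<open>sequentially\<close> along which all coordinates
converge at once. Identities and non-strict inequalities that hold eventually pass to \<open>l\<close>.
\<close>

lemma bounded_sequence_limit_along_filter:
  fixes d :: "nat \<Rightarrow> 'i \<Rightarrow> real"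
  assumes bounds: "\<And>j i. d j i \<in> {a i..b i}"
  shows "\<exists>F l. F \<noteq> bot \<and> F \<le> sequentially \<and> (\<forall>i. ((\<lambda>j. d j i) \<longlongrightarrow> l i) F)"
proof -
  let ?P = "PiE UNIV (\<lambda>i. {a i..b i})"
  have "compactin (product_topology (\<lambda>_. euclidean) UNIV) ?P"
    by (simp add: compactin_PiE)
  then have "compact ?P"
    by (simp add: euclidean_product_topology)
  moreover have "eventually (\<lambda>f. f \<in> ?P) (filtermap d sequentially)"
    using bounds by (auto simp: eventually_filtermap PiE_iff intro!: always_eventually)
  moreover have "filtermap d sequentially \<noteq> bot"
    by (simp add: filtermap_bot_iff)
  ultimately obtain l where l: "inf (nhds l) (filtermap d sequentially) \<noteq> bot"
    unfolding compact_filter by blast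
  \<comment> \<open>Restricting to the indices at which the sequence is close to the cluster point.\<close>
  define F where "F = inf sequentially (filtercomap d (nhds l))"
  have "F \<noteq> bot"
  proof
    assume "F = bot"
    then obtain P Q where PQ: "eventually P sequentially" "eventually Q (nhds l)"
        "\<And>j. P j \<Longrightarrow> Q (d j) \<Longrightarrow> False"
      unfolding F_def trivial_limit_def eventually_inf eventually_filtercomap by metis
    have "eventually (\<lambda>f. \<not> Q f) (filtermap d sequentially)"
      unfolding eventually_filtermap using PQ(1) by (rule eventually_mono) (use PQ(3) in blast)
    then have "inf (nhds l) (filtermap d sequentially) = bot"
      unfolding trivial_limit_def eventually_inf using PQ(2) by blast
    with l show False ..
  qed
  moreover have "F \<le> sequentially"
    by (simp add: F_def)
  moreover have "((\<lambda>j. d j i) \<longlongrightarrow> l i) F" for i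
  proof -
    have "filterlim d (nhds l) F"
      unfolding F_def by (intro filterlim_inf[THEN iffD2] filterlim_mono[OF filterlim_filtercomap]) auto
    moreover have "filterlim (\<lambda>f. f i) (nhds (l i)) (nhds l)"
    proof (rule topological_tendstoI)
      fix S assume "open S" "l i \<in> S"
      moreover from \<open>open S\<close> have "open ((\<lambda>f. f i) -` S)"
        by (rule open_vimage) simp
      ultimately show "eventually (\<lambda>f. f i \<in> S) (nhds l)"
        unfolding eventually_nhds by (intro exI[of _ "(\<lambda>f. f i) -` S"]) auto
    qed
    ultimately show ?thesis
      by (rule filterlim_compose[rotated])
  qed
  ultimately show ?thesis by blast
qed

text \<open>
Shifting a set amounts to shifting the window, which gains and loses at most one point. The bound does
not depend on the length of the window, so it vanishes in the limit of the densities.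
\<close>

lemma card_window_shift:
  "\<bar>real (card (Suc -` B \<inter> {a..a + n})) - real (card (B \<inter> {a..a + n}))\<bar> \<le> 1"
proof -
  have *: "card (Suc -` B \<inter> {a..a + n}) = card (B \<inter> {Suc a..Suc (a + n)})"
  proof -
    have "B \<inter> {Suc a..Suc (a + n)} = Suc ` (Suc -` B \<inter> {a..a + n})"
      unfolding image_Suc_atLeastAtMost[symmetric] by blast
    then show ?thesis by (simp add: card_image)
  qed
  have "card (B \<inter> {Suc a..Suc (a + n)}) \<le> card (insert (Suc (a + n)) (B \<inter> {a..a + n}))"
    by (rule card_mono) auto
  also have "\<dots> \<le> card (B \<inter> {a..a + n}) + 1"
    by (simp add: card_insert_if)
  finally have 1: "card (B \<inter> {Suc a..Suc (a + n)}) \<le> card (B \<inter> {a..a + n}) + 1" .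
  have "card (B \<inter> {a..a + n}) \<le> card (insert a (B \<inter> {Suc a..Suc (a + n)}))"
    by (rule card_mono) (auto simp: Suc_le_eq)
  also have "\<dots> \<le> card (B \<inter> {Suc a..Suc (a + n)}) + 1"
    by (simp add: card_insert_if)
  finally show ?thesis using 1 * by simp
qed

lemma upper_Banach_density_pos_windows:
  assumes "upper_Banach_density A > 0"
  obtains \<delta> :: real and a N :: "nat \<Rightarrow> nat" where "\<delta> > 0" and "\<And>j. j \<le> N j"
    and "\<And>j. \<delta> \<le> real (card (A \<inter> {a j..a j + N j})) / real (N j + 1)"
proof -
  let ?M = "\<lambda>N. Max (range (\<lambda>m. real (card (A \<inter> {m..m + N})) / real (N + 1)))"
  obtain \<delta> where \<delta>: "0 < ereal \<delta>" "ereal \<delta> < upper_Banach_density A"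
    using ereal_dense2[OF assms] by blast
  have "\<exists>N\<ge>j. \<exists>a. \<delta> \<le> real (card (A \<inter> {a..a + N})) / real (N + 1)" for j
  proof (rule ccontr)
    assume *: "\<not> ?thesis"
    have "?M N \<le> \<delta>" if "j \<le> N" for N
    proof (rule Max.boundedI[OF finite_range_window_density])
      fix r assume "r \<in> range (\<lambda>m. real (card (A \<inter> {m..m + N})) / real (N + 1))"
      then obtain a where r: "r = real (card (A \<inter> {a..a + N})) / real (N + 1)" by blast
      have "\<not> \<delta> \<le> r" unfolding r using * that by blast
      then show "r \<le> \<delta>" by simp
    qed simp
    then have "upper_Banach_density A \<le> ereal \<delta>"
      unfolding upper_Banach_density_def
      by (intro Limsup_bounded) (auto simp: eventually_sequentially)
    with \<delta>(2) show False by simp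
  qed
  then obtain N where N: "\<And>j. j \<le> N j"
    "\<And>j. \<exists>a. \<delta> \<le> real (card (A \<inter> {a..a + N j})) / real (N j + 1)"
    by metis
  from N(2) obtain a where "\<And>j. \<delta> \<le> real (card (A \<inter> {a j..a j + N j})) / real (N j + 1)"
    by metis
  moreover have "0 < \<delta>" using \<delta>(1) by simp
  ultimately show ?thesis using N(1) by (intro that[of \<delta> N a])
qed

text \<open>
The mean is a generalised limit of the densities in windows that grow in length while keeping a fixed
positive share of their points in \<open>A\<close>. The location of the windows is arbitrary; this is why the
upper Banach density, rather than the upper density, is enough.
\<close>

lemma upper_Banach_density_pos_imp_mean:
  assumes "upper_Banach_density A > 0"
  shows "\<exists>m. shift_invariant_mean m \<and> m A > 0"
proof -
  obtain \<delta> and a N :: "nat \<Rightarrow> nat" where "\<delta> > 0" and N: "\<And>j. j \<le> N j"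
    and dens: "\<And>j. \<delta> \<le> real (card (A \<inter> {a j..a j + N j})) / real (N j + 1)"
    using upper_Banach_density_pos_windows[OF assms] by metis
  define d where "d j B = real (card (B \<inter> {a j..a j + N j})) / real (N j + 1)" for j B
  have card_le: "card (B \<inter> {a j..a j + N j}) \<le> N j + 1" for j B
    using card_mono[of "{a j..a j + N j}" "B \<inter> {a j..a j + N j}"] by simp
  then have "d j B \<in> {0..1}" for j B
    using of_nat_mono[OF card_le[of B j], where 'a = real] by (simp add: d_def divide_simps)
  then obtain F m where F: "F \<noteq> bot" "F \<le> sequentially" and lim: "\<And>B. ((\<lambda>j. d j B) \<longlongrightarrow> m B) F"
    using bounded_sequence_limit_along_filter[of d "\<lambda>_. 0" "\<lambda>_. 1"] by blast
  have d_nonneg: "0 \<le> d j B" for j B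
    by (simp add: d_def)
  have "0 \<le> m B" for B
    by (rule tendsto_lowerbound[OF lim _ F(1)]) (simp add: d_nonneg)
  moreover have "m UNIV = 1"
  proof (rule tendsto_unique[OF F(1) lim])
    show "((\<lambda>j. d j UNIV) \<longlongrightarrow> 1) F"
      by (simp add: d_def del: of_nat_Suc)
  qed
  moreover have "m (B \<union> C) = m B + m C" if "B \<inter> C = {}" for B C
  proof (rule tendsto_unique[OF F(1) lim])
    have "d j (B \<union> C) = d j B + d j C" for j
    proof -
      have "card ((B \<union> C) \<inter> {a j..a j + N j}) =
          card (B \<inter> {a j..a j + N j}) + card (C \<inter> {a j..a j + N j})"
        unfolding Int_Un_distrib2 by (rule card_Un_disjoint) (use that in auto)
      then show ?thesis by (simp add: d_def add_divide_distrib)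
    qed
    then show "((\<lambda>j. d j (B \<union> C)) \<longlongrightarrow> m B + m C) F"
      by (simp add: tendsto_add[OF lim lim])
  qed
  moreover have "m (Suc -` B) = m B" for B
  proof -
    have "((\<lambda>j. d j (Suc -` B) - d j B) \<longlongrightarrow> 0) F"
    proof (rule Lim_null_comparison)
      show "((\<lambda>j. 1 / real (Suc j)) \<longlongrightarrow> 0) F"
        using F(2) LIMSEQ_Suc[OF lim_1_over_n] by (rule tendsto_mono)
      have "norm (d j (Suc -` B) - d j B) \<le> 1 / real (Suc j)" for j
      proof -
        have "norm (d j (Suc -` B) - d j B) \<le> 1 / real (N j + 1)"
          using card_window_shift[of B "a j" "N j"]
          by (simp add: d_def diff_divide_distrib[symmetric] divide_right_mono)
        also have "\<dots> \<le> 1 / real (Suc j)"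
          using N[of j] by (simp add: divide_simps)
        finally show ?thesis .
      qed
      then show "eventually (\<lambda>j. norm (d j (Suc -` B) - d j B) \<le> 1 / real (Suc j)) F"
        by simp
    qed
    moreover have "((\<lambda>j. d j (Suc -` B) - d j B) \<longlongrightarrow> m (Suc -` B) - m B) F"
      by (intro tendsto_diff lim)
    ultimately show ?thesis
      using tendsto_unique[OF F(1)] by fastforce
  qed
  moreover have "\<delta> \<le> m A"
    by (rule tendsto_lowerbound[OF lim _ F(1)]) (use dens in \<open>simp add: d_def\<close>)
  ultimately show ?thesis
    using \<open>\<delta> > 0\<close> by (intro exI[of _ m]) (auto simp: shift_invariant_mean_def)
qed

section \<open>Borel measures from contents on compact sets\<close>

lemma le_INF_add_INF_ennreal:
  fixes f g :: "'b \<Rightarrow> ennreal"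
  assumes le: "\<And>u v. u \<in> A \<Longrightarrow> v \<in> B \<Longrightarrow> c \<le> f u + g v"
  shows "c \<le> (INF u\<in>A. f u) + (INF v\<in>B. g v)"
proof (rule ennreal_le_epsilon)
  fix e :: real assume fin: "(INF u\<in>A. f u) + (INF v\<in>B. g v) < top" and "0 < e"
  have less_add: "x < x + ennreal (e / 2)" if "x < top" for x :: ennreal
    using ennreal_add_left_cancel_less[of x 0 "ennreal (e / 2)"] that \<open>0 < e\<close> by simp
  have "(INF u\<in>A. f u) < (INF u\<in>A. f u) + ennreal (e / 2)"
    and "(INF v\<in>B. g v) < (INF v\<in>B. g v) + ennreal (e / 2)"
    using fin by (simp_all only: ennreal_add_less_top less_add)
  then obtain u v where "u \<in> A" "f u < (INF u\<in>A. f u) + ennreal (e / 2)"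
    and "v \<in> B" "g v < (INF v\<in>B. g v) + ennreal (e / 2)"
    unfolding INF_less_iff by blast
  then have "c \<le> ((INF u\<in>A. f u) + ennreal (e / 2)) + ((INF v\<in>B. g v) + ennreal (e / 2))"
    by (intro order_trans[OF le add_mono]) auto
  also have "\<dots> = (INF u\<in>A. f u) + (INF v\<in>B. g v) + (ennreal (e / 2) + ennreal (e / 2))"
    by (simp add: ac_simps)
  also have "ennreal (e / 2) + ennreal (e / 2) = ennreal e"
    using \<open>0 < e\<close> by (simp flip: ennreal_plus)
  finally show "c \<le> (INF u\<in>A. f u) + (INF v\<in>B. g v) + ennreal e" .
qed

text \<open>
A content on the compact sets of a Hausdorff space induces a Borel measure: open sets are measured from inside by compact sets, arbitrary sets from outside by open
sets, and the result is an outer measure for which open sets are Caratheodory measurable.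
\<close>

locale compact_content =
  fixes X :: "'a topology" and content :: "'a set \<Rightarrow> ennreal"
  assumes Hausdorff: "Hausdorff_space X"
    and content_empty: "content {} = 0"
    and content_subadd: "\<lbrakk>compactin X K; compactin X L\<rbrakk> \<Longrightarrow> content (K \<union> L) \<le> content K + content L"
    and content_superadd: "\<lbrakk>compactin X K; compactin X L; K \<inter> L = {}\<rbrakk> \<Longrightarrow>
      content K + content L \<le> content (K \<union> L)"
begin

definition inner :: "'a set \<Rightarrow> ennreal" where
  "inner U = (SUP K\<in>{K. compactin X K \<and> K \<subseteq> U}. content K)"

definition outer :: "'a set \<Rightarrow> ennreal" where
  "outer A = (INF U\<in>{U. openin X U \<and> A \<subseteq> U}. inner U)"

lemma content_le_inner: "\<lbrakk>compactin X K; K \<subseteq> U\<rbrakk> \<Longrightarrow> content K \<le> inner U"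
  unfolding inner_def by (rule SUP_upper) simp

lemma inner_mono: "U \<subseteq> V \<Longrightarrow> inner U \<le> inner V"
  unfolding inner_def by (rule SUP_subset_mono) auto

lemma inner_empty: "inner {} = 0"
proof -
  have "{K. compactin X K \<and> K \<subseteq> {}} = {{}}" by auto
  then show ?thesis by (simp add: inner_def content_empty)
qed

lemma outer_mono: "A \<subseteq> B \<Longrightarrow> outer A \<le> outer B"
  unfolding outer_def by (rule INF_superset_mono) auto

lemma outer_le_inner: "\<lbrakk>openin X U; A \<subseteq> U\<rbrakk> \<Longrightarrow> outer A \<le> inner U"
  unfolding outer_def by (rule INF_lower) simp

lemma outer_open: "openin X U \<Longrightarrow> outer U = inner U"
  by (rule antisym) (auto simp: outer_le_inner, auto simp: outer_def intro!: INF_greatest inner_mono)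

lemma content_le_outer: "compactin X K \<Longrightarrow> content K \<le> outer K"
  unfolding outer_def by (auto intro!: INF_greatest content_le_inner)

lemma compactin_diff_open:
  assumes "compactin X K" "openin X U"
  shows "compactin X (K - U)"
proof -
  have "K - U = (topspace X - U) \<inter> K"
    using compactin_subset_topspace[OF assms(1)] by auto
  then show ?thesis
    using closed_Int_compactin[of X "topspace X - U" K] assms by (simp add: openin_closedin_eq)
qed

text \<open>
The closed pieces \<open>K - U\<close> and \<open>K - V\<close> are disjoint and compact, so they have disjoint open
neighbourhoods; removing one of these from \<open>K\<close> at a time splits \<open>K\<close> along the cover.
\<close>

lemma compactin_Un_split:
  assumes "compactin X K" "openin X U" "openin X V" "K \<subseteq> U \<union> V"
  obtains K1 K2 where "compactin X K1" "compactin X K2" "K1 \<subseteq> U" "K2 \<subseteq> V" "K = K1 \<union> K2"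
proof -
  have "disjnt (K - U) (K - V)"
    using assms(4) by (auto simp: disjnt_def)
  then obtain G H where "openin X G" "openin X H" "K - U \<subseteq> G" "K - V \<subseteq> H" "disjnt G H"
    using Hausdorff_space_compact_separation[OF Hausdorff, of "K - U" "K - V"]
      compactin_diff_open assms by metis
  then show ?thesis
    by (intro that[of "K - G" "K - H"] compactin_diff_open assms(1)) (auto simp: disjnt_def)
qed

lemma inner_Un:
  assumes "openin X U" "openin X V"
  shows "inner (U \<union> V) \<le> inner U + inner V"
  unfolding inner_def[of "U \<union> V"]
proof (rule SUP_least, clarify)
  fix K assume "compactin X K" "K \<subseteq> U \<union> V"
  then obtain K1 K2 where K: "compactin X K1" "compactin X K2" "K1 \<subseteq> U" "K2 \<subseteq> V" "K = K1 \<union> K2"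
    using compactin_Un_split assms by metis
  then have "content K \<le> content K1 + content K2"
    using content_subadd by simp
  also have "\<dots> \<le> inner U + inner V"
    using K by (intro add_mono content_le_inner)
  finally show "content K \<le> inner U + inner V" .
qed

text \<open>
A compact subset of the union meets only finitely many members of the cover, which reduces countable
subadditivity to the finite case.
\<close>

lemma inner_UN:
  fixes U :: "nat \<Rightarrow> 'a set"
  assumes U: "\<And>i. openin X (U i)"
  shows "inner (\<Union>i. U i) \<le> (\<Sum>i. inner (U i))"
proof -
  have finite_case: "inner (\<Union>i<n. U i) \<le> (\<Sum>i<n. inner (U i))" for n
  proof (induction n)
    case 0
    then show ?case by (simp add: inner_empty)
  next
    case (Suc n)
    have "inner (\<Union>i<Suc n. U i) \<le> inner (\<Union>i<n. U i) + inner (U n)"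
      using inner_Un[of "\<Union>i<n. U i" "U n"] U by (auto simp: lessThan_Suc Un_commute)
    with Suc show ?case by (auto intro: order_trans add_right_mono)
  qed
  show ?thesis
    unfolding inner_def[of "\<Union>i. U i"]
  proof (rule SUP_least, clarify)
    fix K assume K: "compactin X K" "K \<subseteq> (\<Union>i. U i)"
    then obtain \<F> where "finite \<F>" "\<F> \<subseteq> range U" "K \<subseteq> \<Union>\<F>"
      using compactinD[OF K(1), of "range U"] U by auto
    then obtain I where "finite I" "K \<subseteq> (\<Union>i\<in>I. U i)"
      by (metis finite_subset_image)
    moreover from \<open>finite I\<close> obtain n where "I \<subseteq> {..<n}"
      by (metis finite_nat_iff_bounded)
    ultimately have "K \<subseteq> (\<Union>i<n. U i)" by blast
    with K(1) have "content K \<le> inner (\<Union>i<n. U i)"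
      by (rule content_le_inner)
    also have "\<dots> \<le> (\<Sum>i<n. inner (U i))" by (rule finite_case)
    also have "\<dots> \<le> (\<Sum>i. inner (U i))"
      by (rule sum_le_suminf) auto
    finally show "content K \<le> (\<Sum>i. inner (U i))" .
  qed
qed

lemma outer_UN:
  fixes A :: "nat \<Rightarrow> 'a set"
  shows "outer (\<Union>i. A i) \<le> (\<Sum>i. outer (A i))"
proof (rule ennreal_le_epsilon)
  fix e :: real assume "0 < e" "(\<Sum>n. outer (A n)) < top"
  then have *: "\<And>n. outer (A n) < outer (A n) + e * (1/2)^Suc n"
    by (auto simp add: less_top dest!: ennreal_suminf_lessD)
  have "\<exists>U. openin X U \<and> A n \<subseteq> U \<and> inner U < outer (A n) + e * (1/2)^Suc n" for n
    using *[of n] unfolding outer_def INF_less_iff by auto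
  then obtain U where U: "\<And>n. openin X (U n)" "\<And>n. A n \<subseteq> U n"
      "\<And>n. inner (U n) < outer (A n) + e * (1/2)^Suc n"
    by metis
  have "outer (\<Union>i. A i) \<le> inner (\<Union>i. U i)"
    using U by (intro outer_le_inner) blast+
  also have "\<dots> \<le> (\<Sum>n. inner (U n))"
    by (rule inner_UN) (rule U)
  also have "\<dots> \<le> (\<Sum>n. outer (A n) + e * (1/2)^Suc n)"
    using U(3) by (intro suminf_le less_imp_le) auto
  also have "\<dots> = (\<Sum>n. outer (A n)) + (\<Sum>n. ennreal e * ennreal ((1/2) ^ Suc n))"
    using \<open>0 < e\<close> by (subst suminf_add[symmetric])
                     (auto simp del: ennreal_suminf_cmult simp add: ennreal_mult[symmetric])
  also have "\<dots> = (\<Sum>n. outer (A n)) + e"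
    unfolding ennreal_suminf_cmult
    by (subst suminf_ennreal_eq[OF zero_le_power power_half_series]) auto
  finally show "outer (\<Union>i. A i) \<le> (\<Sum>n. outer (A n)) + e" .
qed

lemma outer_measure_space_outer: "outer_measure_space (Pow (topspace X)) outer"
  unfolding outer_measure_space_def positive_def increasing_def countably_subadditive_def
  by (auto simp: outer_open inner_empty intro: outer_mono outer_UN)

text \<open>
For a compact \<open>K \<subseteq> V \<inter> U\<close> the set \<open>V - K\<close> is open and contains \<open>V - U\<close>, and every compact
\<open>L \<subseteq> V - K\<close> is disjoint from \<open>K\<close>. Superadditivity of the content then bounds
\<open>content K + content L\<close> by \<open>inner V\<close>; taking suprema over \<open>L\<close> and then over \<open>K\<close> gives the claim.
\<close>

lemma inner_split_open:
  assumes "openin X U" "openin X V"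
  shows "outer (V \<inter> U) + outer (V - U) \<le> inner V"
proof -
  have fixed_compact: "content K + outer (V - U) \<le> inner V" if K: "compactin X K" "K \<subseteq> V \<inter> U" for K
  proof -
    have "openin X (V - K)"
      using assms(2) compactin_imp_closedin[OF Hausdorff K(1)] by (rule openin_diff)
    then have "outer (V - U) \<le> inner (V - K)"
      by (rule outer_le_inner) (use K in auto)
    then have "content K + outer (V - U) \<le> content K + inner (V - K)"
      by (rule add_left_mono)
    also have "\<dots> = (SUP L\<in>{L. compactin X L \<and> L \<subseteq> V - K}. content K + content L)"
      unfolding inner_def
      by (rule ennreal_SUP_add_right) auto
    also have "\<dots> \<le> inner V"
    proof (rule SUP_least, clarify)
      fix L assume L: "compactin X L" "L \<subseteq> V - K"
      have "content K + content L \<le> content (K \<union> L)"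
        using K L by (intro content_superadd) auto
      also have "\<dots> \<le> inner V"
        using K L by (intro content_le_inner compactin_Un) auto
      finally show "content K + content L \<le> inner V" .
    qed
    finally show ?thesis .
  qed
  have "inner (V \<inter> U) + outer (V - U) =
      (SUP K\<in>{K. compactin X K \<and> K \<subseteq> V \<inter> U}. content K + outer (V - U))"
    unfolding inner_def by (rule ennreal_SUP_add_left[symmetric]) auto
  also have "\<dots> \<le> inner V"
    using fixed_compact by (intro SUP_least) auto
  finally show ?thesis using assms by (simp add: outer_open openin_Int)
qed

lemma open_in_lambda_system:
  assumes "openin X U"
  shows "U \<in> lambda_system (topspace X) (Pow (topspace X)) outer"
proof -
  interpret algebra "topspace X" "Pow (topspace X)" by (rule algebra_Pow)
  have "outer (A \<inter> U) + outer (A - U) = outer A" if "A \<subseteq> topspace X" for A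
  proof (rule antisym)
    show "outer (A \<inter> U) + outer (A - U) \<le> outer A"
      unfolding outer_def[of A]
    proof (rule INF_greatest, clarify)
      fix V assume "openin X V" "A \<subseteq> V"
      then have "outer (A \<inter> U) + outer (A - U) \<le> outer (V \<inter> U) + outer (V - U)"
        by (intro add_mono outer_mono) auto
      also have "\<dots> \<le> inner V"
        by (rule inner_split_open) fact+
      finally show "outer (A \<inter> U) + outer (A - U) \<le> inner V" .
    qed
    have "subadditive (Pow (topspace X)) outer"
      using outer_measure_space_outer countably_subadditive_subadditive
      by (simp add: outer_measure_space_def)
    then have "outer ((A \<inter> U) \<union> (A - U)) \<le> outer (A \<inter> U) + outer (A - U)"
      by (rule subadditiveD) (use that in auto)
    then show "outer A \<le> outer (A \<inter> U) + outer (A - U)"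
      by (simp add: Int_Diff_Un)
  qed
  then show ?thesis
    using openin_subset[OF assms] by (auto simp: lambda_system_eq)
qed

definition borel_extension :: "'a measure" where
  "borel_extension = measure_of (topspace X) {U. openin X U} outer"

lemma space_borel_extension: "space borel_extension = topspace X"
  unfolding borel_extension_def by (rule space_measure_of) (auto dest: openin_subset)

lemma sets_borel_extension: "sets borel_extension = sigma_sets (topspace X) {U. openin X U}"
  unfolding borel_extension_def by (rule sets_measure_of) (auto dest: openin_subset)

lemma emeasure_borel_extension:
  assumes "A \<in> sets borel_extension"
  shows "emeasure borel_extension A = outer A"
proof (rule emeasure_measure_of[OF borel_extension_def _ _ _ assms])
  interpret sigma_algebra "topspace X" "Pow (topspace X)" by (rule sigma_algebra_Pow)
  let ?L = "lambda_system (topspace X) (Pow (topspace X)) outer"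
  have ms: "measure_space (topspace X) ?L outer"
    by (rule caratheodory_lemma[OF outer_measure_space_outer])
  then interpret L: sigma_algebra "topspace X" ?L
    by (simp add: measure_space_def)
  have sub: "sets borel_extension \<subseteq> ?L"
    unfolding sets_borel_extension by (rule L.sigma_sets_subset) (auto simp: open_in_lambda_system)
  show "positive (sets borel_extension) outer"
    by (simp add: positive_def outer_open inner_empty)
  show "countably_additive (sets borel_extension) outer"
    using ms sub unfolding measure_space_def countably_additive_def by blast
  show "{U. openin X U} \<subseteq> Pow (topspace X)" by (auto dest: openin_subset)
qed

end

text \<open>
A finitely additive set function on open sets is turned into a content by taking outer values on
compact sets. Superadditivity is where the Hausdorff property enters: disjoint compact sets have
disjoint open neighbourhoods.
\<close>

lemma compact_content_INF_open:
  assumes "Hausdorff_space X" and empty: "q {} = 0"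
    and mono: "\<And>U V. openin X U \<Longrightarrow> openin X V \<Longrightarrow> U \<subseteq> V \<Longrightarrow> q U \<le> q V"
    and subadd: "\<And>U V. openin X U \<Longrightarrow> openin X V \<Longrightarrow> q (U \<union> V) \<le> q U + q V"
    and superadd: "\<And>U V. openin X U \<Longrightarrow> openin X V \<Longrightarrow> U \<inter> V = {} \<Longrightarrow> q U + q V \<le> q (U \<union> V)"
  shows "compact_content X (\<lambda>K. INF U\<in>{U. openin X U \<and> K \<subseteq> U}. q U)"
proof
  let ?c = "\<lambda>K. INF U\<in>{U. openin X U \<and> K \<subseteq> U}. q U"
  show "Hausdorff_space X" by fact
  have "?c {} \<le> q {}" by (rule INF_lower) simp
  then show "?c {} = 0" using empty by simp
  show "?c (K \<union> L) \<le> ?c K + ?c L" for K L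
  proof (rule le_INF_add_INF_ennreal, clarify)
    fix U V assume "openin X U" "K \<subseteq> U" "openin X V" "L \<subseteq> V"
    then have "?c (K \<union> L) \<le> q (U \<union> V)" by (intro INF_lower) auto
    also have "\<dots> \<le> q U + q V" by (rule subadd) fact+
    finally show "?c (K \<union> L) \<le> q U + q V" .
  qed
  show "?c K + ?c L \<le> ?c (K \<union> L)" if K: "compactin X K" and L: "compactin X L" and "K \<inter> L = {}" for K L
  proof (rule INF_greatest, clarify)
    fix W assume W: "openin X W" "K \<union> L \<subseteq> W"
    obtain U V where UV: "openin X U" "openin X V" "K \<subseteq> U" "L \<subseteq> V" "disjnt U V"
      using Hausdorff_space_compact_separation[OF assms(1) K L] \<open>K \<inter> L = {}\<close> by (auto simp: disjnt_def)
    have "?c K + ?c L \<le> q (W \<inter> U) + q (W \<inter> V)"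
      using UV W by (intro add_mono INF_lower) (auto simp: openin_Int)
    also have "\<dots> \<le> q ((W \<inter> U) \<union> (W \<inter> V))"
      using UV W by (intro superadd) (auto simp: openin_Int disjnt_def)
    also have "\<dots> \<le> q W"
      using UV W by (intro mono) (auto simp: openin_Int openin_Un)
    finally show "?c K + ?c L \<le> q W" .
  qed
qed

section \<open>From recurrence to invariant measures\<close>

text \<open>
One inequality suffices, because applying it to the complement of \<open>A\<close> reverses it when the total
mass is finite.
\<close>

lemma (in finite_measure) invariant_if_preimage_le:
  assumes T: "T \<in> measurable M M"
    and le: "\<And>A. A \<in> sets M \<Longrightarrow> emeasure M (T -` A \<inter> space M) \<le> emeasure M A"
    and A: "A \<in> sets M"
  shows "emeasure M (T -` A \<inter> space M) = emeasure M A"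
proof (rule antisym[OF le[OF A]])
  have TA: "T -` A \<inter> space M \<in> sets M" using T A by (rule measurable_sets)
  have "measure M (space M) - measure M (T -` A \<inter> space M) = measure M (space M - (T -` A \<inter> space M))"
    using finite_measure_compl[OF TA] by simp
  also have "space M - (T -` A \<inter> space M) = T -` (space M - A) \<inter> space M"
    using measurable_space[OF T] by auto
  also have "measure M \<dots> \<le> measure M (space M - A)"
    using le[of "space M - A"] A by (simp add: emeasure_eq_measure)
  also have "\<dots> = measure M (space M) - measure M A"
    by (rule finite_measure_compl) (rule A)
  finally show "emeasure M A \<le> emeasure M (T -` A \<inter> space M)"
    by (simp add: emeasure_eq_measure)
qed

text \<open>
Every open set \<open>U\<close> is covered by the interiors of the \<open>\<tau>\<close>-compact sets inside \<open>U\<close>, and by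
second countability countably many of them suffice. Hence \<open>U\<close> is a countable union of sets that
are \<open>\<tau>\<close>-compact, thus \<open>\<tau>\<close>-closed.
\<close>

lemma borel_eq_sigma_coarser:
  fixes \<tau> :: "'a::second_countable_topology topology"
  assumes "topspace \<tau> = UNIV" and "Hausdorff_space \<tau>"
    and coarser: "\<And>U. openin \<tau> U \<Longrightarrow> open U"
    and base: "neighbourhood_base_of (compactin \<tau>) (euclidean :: 'a topology)"
  shows "sigma_sets UNIV {U. openin \<tau> U} = sets (borel :: 'a measure)"
proof
  interpret S: sigma_algebra UNIV "sigma_sets UNIV {U. openin \<tau> U}"
    by (rule sigma_algebra_sigma_sets) simp
  have compact_in: "K \<in> sigma_sets UNIV {U. openin \<tau> U}" if "compactin \<tau> K" for K
  proof -
    have "openin \<tau> (UNIV - K)"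
      using compactin_imp_closedin[OF assms(2) that] assms(1) by (metis closedin_def)
    then have "UNIV - (UNIV - K) \<in> sigma_sets UNIV {U. openin \<tau> U}"
      by (intro S.compl_sets sigma_sets.Basic) simp
    then show ?thesis by (simp add: double_diff)
  qed
  have "U \<in> sigma_sets UNIV {U. openin \<tau> U}" if "open U" for U :: "'a set"
  proof -
    let ?F = "{interior K | K. compactin \<tau> K \<and> K \<subseteq> U}"
    have cover: "\<exists>G\<in>?F. x \<in> G" if "x \<in> U" for x
    proof -
      obtain V K where "open V" "compactin \<tau> K" "x \<in> V" "V \<subseteq> K" "K \<subseteq> U"
        using base \<open>open U\<close> \<open>x \<in> U\<close> unfolding neighbourhood_base_of by (metis open_openin)
      then have "x \<in> interior K" by (auto dest: interior_maximal)
      with \<open>compactin \<tau> K\<close> \<open>K \<subseteq> U\<close> show ?thesis by blast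
    qed
    obtain F' where F': "F' \<subseteq> ?F" "countable F'" "\<Union>F' = \<Union>?F"
      by (rule Lindelof[of ?F]) auto
    obtain k where k: "\<And>G. G \<in> F' \<Longrightarrow> G = interior (k G) \<and> compactin \<tau> (k G) \<and> k G \<subseteq> U"
      using F'(1) by (simp add: subset_iff) metis
    have "U = (\<Union>G\<in>F'. k G)"
    proof
      show "U \<subseteq> (\<Union>G\<in>F'. k G)"
      proof
        fix x assume "x \<in> U"
        then obtain G where "G \<in> F'" "x \<in> G" using cover F'(3) by blast
        then show "x \<in> (\<Union>G\<in>F'. k G)" using k interior_subset by blast
      qed
    qed (use k in auto)
    also have "\<dots> \<in> sigma_sets UNIV {U. openin \<tau> U}"
      using F'(2) k by (intro S.countable_UN' ) (auto intro: compact_in)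
    finally show ?thesis .
  qed
  then show "sets borel \<subseteq> sigma_sets UNIV {U. openin \<tau> U}"
    using S.sigma_sets_subset[of "{S. open S}"] unfolding borel_def by auto
  show "sigma_sets UNIV {U. openin \<tau> U} \<subseteq> sets (borel :: 'a measure)"
  proof -
    have "{U. openin \<tau> U} \<subseteq> sets (borel :: 'a measure)"
      using coarser by (auto intro: borel_open)
    from sets.sigma_sets_subset[OF this] show ?thesis by simp
  qed
qed

lemma visit_times_vimage: "visit_times T x (T -` A) = Suc -` visit_times T x A"
  by (auto simp: visit_times_def)

text \<open>
The mean of the visit times to a set is a finitely additive, \<open>T\<close>-invariant set function \<open>q\<close>.
Its associated Borel measure is dominated by \<open>q\<close> on \<open>\<tau>\<close>-open sets, so it is finite and does not
charge the complement of the orbit closure, and it dominates \<open>q\<close> on \<open>\<tau>\<close>-compact sets, so it charges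
\<open>K\<close>. Mass may be lost in passing from \<open>q\<close> to the measure, which is why the total mass has to be
normalised and why only its positivity on \<open>K\<close> is asserted.
\<close>

lemma invariant_measure_from_mean:
  fixes T :: "'a::topological_space \<Rightarrow> 'a" and \<tau> :: "'a topology"
  assumes contT: "continuous_on UNIV T" and top: "topspace \<tau> = UNIV"
    and haus: "Hausdorff_space \<tau>" and cont\<tau>: "continuous_map \<tau> \<tau> T"
    and borel: "sigma_sets UNIV {U. openin \<tau> U} = sets (borel :: 'a measure)"
    and mean: "shift_invariant_mean m"
    and K: "compactin \<tau> K" and pos: "m (visit_times T x K) > 0"
  shows "\<exists>\<mu>. invariant_prob_measure T \<mu> \<and> emeasure \<mu> K > 0 \<and>
             emeasure \<mu> (- (\<tau> closure_of forward_orbit T x)) = 0"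
proof -
  define q where "q U = ennreal (m (visit_times T x U))" for U
  define c where "c K = (INF U\<in>{U. openin \<tau> U \<and> K \<subseteq> U}. q U)" for K
  have m_nonneg: "0 \<le> m B" for B
    by (rule shift_invariant_mean_nonneg[OF mean])
  have q_mono: "q U \<le> q V" if "U \<subseteq> V" for U V
    unfolding q_def using that
    by (intro ennreal_leI shift_invariant_mean_mono[OF mean]) (auto simp: visit_times_def)
  have q_empty: "q {} = 0"
    using shift_invariant_mean_empty[OF mean] by (simp add: q_def visit_times_def)
  have q_vimage: "q (T -` U) = q U" for U
    by (simp add: q_def visit_times_vimage shift_invariant_mean_vimage_Suc[OF mean])
  have visit_Un: "visit_times T x (U \<union> V) = visit_times T x U \<union> visit_times T x V" for U V
    by (auto simp: visit_times_def)
  have q_Un_le: "q (U \<union> V) \<le> q U + q V" for U V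
    unfolding q_def visit_Un using shift_invariant_mean_Un_le[OF mean]
    by (simp add: m_nonneg flip: ennreal_plus)
  have q_Un_disjoint: "q (U \<union> V) = q U + q V" if "U \<inter> V = {}" for U V
  proof -
    have "visit_times T x U \<inter> visit_times T x V = {}"
      using that by (auto simp: visit_times_def)
    then show ?thesis
      by (simp add: q_def visit_Un shift_invariant_mean_Un_disjoint[OF mean] m_nonneg)
  qed
  interpret compact_content \<tau> c
    unfolding c_def
    by (rule compact_content_INF_open[OF haus]) (simp_all add: q_empty q_mono q_Un_le q_Un_disjoint)
  let ?M = borel_extension
  have sets_M: "sets ?M = sets borel" and space_M: "space ?M = UNIV"
    using borel by (simp_all add: sets_borel_extension space_borel_extension top)
  have open_sets: "openin \<tau> U \<Longrightarrow> U \<in> sets ?M" for U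
    by (simp add: sets_borel_extension)
  have M_open_le: "emeasure ?M U \<le> q U" if "openin \<tau> U" for U
  proof -
    have "emeasure ?M U = inner U"
      using that by (simp add: emeasure_borel_extension open_sets outer_open)
    also have "\<dots> \<le> q U"
      unfolding inner_def c_def using that by (intro SUP_least INF_lower) auto
    finally show ?thesis .
  qed
  \<comment> \<open>Preimages of open neighbourhoods of the compact set \<open>T ` L\<close> are neighbourhoods of \<open>L\<close>
    with the same mean. This yields one half of the invariance, and the other half follows from
    finiteness of the measure.\<close>
  have c_image_le: "c L \<le> c (T ` L)" for L
    unfolding c_def
  proof (rule INF_greatest, clarify)
    fix U assume U: "openin \<tau> U" "T ` L \<subseteq> U"
    then have "openin \<tau> (T -` U)"
      using openin_continuous_map_preimage[OF cont\<tau> U(1)] top by (simp add: vimage_def)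
    then have "c L \<le> q (T -` U)"
      unfolding c_def using U(2) by (intro INF_lower) auto
    then show "(INF U\<in>{U. openin \<tau> U \<and> L \<subseteq> U}. q U) \<le> q U"
      by (simp add: q_vimage c_def)
  qed
  have inner_vimage_le: "inner (T -` U) \<le> inner U" for U
    unfolding inner_def[of "T -` U"]
  proof (rule SUP_least, clarify)
    fix L assume "compactin \<tau> L" "L \<subseteq> T -` U"
    then have "c (T ` L) \<le> inner U"
      by (intro content_le_inner image_compactin[OF _ cont\<tau>]) auto
    then show "c L \<le> inner U"
      using c_image_le by (rule order_trans[rotated])
  qed
  have outer_vimage_le: "outer (T -` A) \<le> outer A" for A
    unfolding outer_def[of A]
  proof (rule INF_greatest, clarify)
    fix U assume U: "openin \<tau> U" "A \<subseteq> U"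
    then have "outer (T -` A) \<le> inner (T -` U)"
      using openin_continuous_map_preimage[OF cont\<tau> U(1)] top
      by (intro outer_le_inner) (auto simp: vimage_def)
    then show "outer (T -` A) \<le> inner U"
      using inner_vimage_le by (rule order_trans)
  qed
  have "emeasure ?M UNIV \<le> q UNIV"
    using M_open_le openin_topspace[of \<tau>] top by simp
  then have total_le: "emeasure ?M UNIV \<le> 1"
    by (simp add: q_def visit_times_def shift_invariant_mean_UNIV[OF mean])
  interpret finite_measure ?M
    using total_le by (intro finite_measureI) (auto simp: space_M top_unique)
  have measT: "T \<in> measurable ?M ?M"
    using borel_measurable_continuous_onI[OF contT] by (simp add: sets_M cong: measurable_cong_sets)
  have inv: "emeasure ?M (T -` A) = emeasure ?M A" if A: "A \<in> sets borel" for A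
  proof -
    have "emeasure ?M (T -` B \<inter> space ?M) \<le> emeasure ?M B" if "B \<in> sets ?M" for B
      using measurable_sets[OF measT that] that
      by (simp add: space_M emeasure_borel_extension outer_vimage_le)
    from invariant_if_preimage_le[OF measT this, of A] A show ?thesis
      by (simp add: space_M sets_M)
  qed
  have "0 < q K" using pos by (simp add: q_def)
  also have "q K \<le> c K" unfolding c_def by (auto intro!: INF_greatest q_mono)
  also have "c K \<le> emeasure ?M K"
  proof -
    have "closedin \<tau> K"
      using haus K by (rule compactin_imp_closedin)
    then have "openin \<tau> (UNIV - K)" using top by (metis closedin_def)
    then have "space ?M - (UNIV - K) \<in> sets ?M" by (intro sets.compl_sets open_sets)
    then show ?thesis
      using content_le_outer[OF K] by (simp add: space_M double_diff emeasure_borel_extension)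
  qed
  finally have M_K: "0 < emeasure ?M K" .
  also have "\<dots> \<le> emeasure ?M UNIV" using emeasure_space[of ?M K] by (simp add: space_M)
  finally have total_pos: "0 < emeasure ?M UNIV" .
  define \<mu> where "\<mu> = scale_measure (inverse (emeasure ?M UNIV)) ?M"
  have em: "emeasure \<mu> A = inverse (emeasure ?M UNIV) * emeasure ?M A" for A
    by (simp add: \<mu>_def)
  have fin: "emeasure ?M UNIV \<noteq> top"
    using total_le by (auto simp: top_unique)
  have "invariant_prob_measure T \<mu>"
    unfolding invariant_prob_measure_def
  proof (intro conjI ballI)
    show "prob_space \<mu>"
    proof
      show "emeasure \<mu> (space \<mu>) = 1"
        using ennreal_divide_self[OF gr_implies_not_zero[OF total_pos]] fin[unfolded less_top] em[of UNIV]
        by (simp add: \<mu>_def space_scale_measure space_M divide_ennreal_def mult.commute)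
    qed
    show "sets \<mu> = sets borel" by (simp add: \<mu>_def sets_M)
    show "emeasure \<mu> (T -` A) = emeasure \<mu> A" if "A \<in> sets borel" for A
      by (simp add: em inv that)
  qed
  moreover have "0 < emeasure \<mu> K"
    using M_K fin by (simp add: em ennreal_zero_less_mult_iff ennreal_inverse_positive)
  moreover have "emeasure \<mu> (- (\<tau> closure_of forward_orbit T x)) = 0"
  proof -
    let ?C = "\<tau> closure_of forward_orbit T x"
    have "openin \<tau> (- ?C)"
      using closedin_closure_of[of \<tau> "forward_orbit T x"] top by (simp add: closedin_def Compl_eq_Diff_UNIV)
    then have "emeasure ?M (- ?C) \<le> q (- ?C)" by (rule M_open_le)
    moreover have "visit_times T x (- ?C) = {}"
      using closure_of_subset[of "forward_orbit T x" \<tau>] top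
      by (auto simp: visit_times_def forward_orbit_def)
    ultimately show ?thesis
      using q_empty by (simp add: em q_def visit_times_def)
  qed
  ultimately show ?thesis by blast
qed

text \<open>
Averaging countably many measures with positive weights, here those of a geometric distribution,
keeps invariance and common null sets, and charges every set that one of them charges.
\<close>

lemma countable_mixture_of_invariant_measures:
  fixes T :: "'a::topological_space \<Rightarrow> 'a"
  assumes contT: "continuous_on UNIV T" and "countable \<U>" "\<U> \<noteq> {}" and N: "N \<in> sets borel"
    and borel: "\<And>U. U \<in> \<U> \<Longrightarrow> U \<in> sets borel"
    and ex: "\<And>U. U \<in> \<U> \<Longrightarrow> \<exists>\<mu>. invariant_prob_measure T \<mu> \<and> emeasure \<mu> U > 0 \<and> emeasure \<mu> N = 0"
  shows "\<exists>\<mu>. invariant_prob_measure T \<mu> \<and> (\<forall>U\<in>\<U>. emeasure \<mu> U > 0) \<and> emeasure \<mu> N = 0"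
proof -
  obtain \<nu> where \<nu>: "\<And>U. U \<in> \<U> \<Longrightarrow> invariant_prob_measure T (\<nu> U)"
      "\<And>U. U \<in> \<U> \<Longrightarrow> emeasure (\<nu> U) U > 0" "\<And>U. U \<in> \<U> \<Longrightarrow> emeasure (\<nu> U) N = 0"
    using ex by metis
  define f where "f n = \<nu> (from_nat_into \<U> n)" for n
  have elem: "from_nat_into \<U> n \<in> \<U>" for n
    using \<open>\<U> \<noteq> {}\<close> by (rule from_nat_into)
  let ?p = "measure_pmf (geometric_pmf (1/2))"
  have p: "?p \<in> space (prob_algebra (count_space UNIV))"
    by (simp add: space_prob_algebra prob_space_measure_pmf)
  have f: "f \<in> measurable (count_space UNIV) (prob_algebra borel)"
    using \<nu>(1)[OF elem] by (auto simp: f_def space_prob_algebra invariant_prob_measure_def)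
  define \<mu> where "\<mu> = bind ?p f"
  have em: "emeasure \<mu> A = (\<integral>\<^sup>+n. emeasure (f n) A \<partial>?p)" if "A \<in> sets borel" for A
    unfolding \<mu>_def using p f that by (rule emeasure_bind_prob_algebra)
  have em_0: "emeasure \<mu> A = 0 \<longleftrightarrow> (\<forall>n. emeasure (f n) A = 0)" if "A \<in> sets borel" for A
    using that by (simp add: em nn_integral_0_iff_AE AE_measure_pmf_iff set_pmf_geometric)
  have "invariant_prob_measure T \<mu>"
    unfolding invariant_prob_measure_def
  proof (intro conjI ballI)
    show "prob_space \<mu>" "sets \<mu> = sets borel"
      unfolding \<mu>_def using p f by (rule prob_space_bind', rule sets_bind')
    show "emeasure \<mu> (T -` A) = emeasure \<mu> A" if A: "A \<in> sets borel" for A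
    proof -
      have "T -` A \<in> sets borel"
        using measurable_sets[OF borel_measurable_continuous_onI[OF contT] A] by simp
      then show ?thesis
        using \<nu>(1)[OF elem] A by (simp add: em f_def invariant_prob_measure_def)
    qed
  qed
  moreover have "emeasure \<mu> U > 0" if U: "U \<in> \<U>" for U
  proof -
    obtain n where "from_nat_into \<U> n = U"
      using from_nat_into_surj[OF \<open>countable \<U>\<close> U] by blast
    then have "emeasure (f n) U \<noteq> 0" using \<nu>(2)[OF U] by (simp add: f_def)
    then show ?thesis using em_0[OF borel[OF U]] by (auto simp: zero_less_iff_neq_zero)
  qed
  moreover have "emeasure \<mu> N = 0"
    using \<nu>(3)[OF elem] by (simp add: em_0[OF N] f_def)
  ultimately show ?thesis by blast
qed

theorem theorem2p3:
  fixes T :: "'a::polish_space \<Rightarrow> 'a" and \<tau> :: "'a topology"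
  assumes "continuous_on UNIV T"
    and "topspace \<tau> = UNIV"
    and "Hausdorff_space \<tau>"
    and "continuous_map \<tau> \<tau> T"
    and "\<And>U. openin \<tau> U \<Longrightarrow> open U"
    and "neighbourhood_base_of (compactin \<tau>) (euclidean :: 'a topology)"
  shows "(\<forall>x0. reiteratively_recurrent_point T x0 \<longrightarrow>
            (\<exists>\<mu>. invariant_prob_measure T \<mu> \<and>
                 x0 \<in> measure_support \<mu> \<and>
                 measure_support \<mu> \<subseteq> \<tau> closure_of (forward_orbit T x0))) \<and>
         (reiteratively_recurrent T \<longrightarrow>
            (\<exists>\<mu>. invariant_prob_measure T \<mu> \<and> full_support \<mu>))"
proof -
  have borel: "sigma_sets UNIV {U. openin \<tau> U} = sets (borel :: 'a measure)"
    by (rule borel_eq_sigma_coarser) (use assms in auto)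
  have pos_mono: "emeasure \<mu> U > 0"
    if "invariant_prob_measure T \<mu>" "open U" "B \<subseteq> U" "emeasure \<mu> B > 0" for \<mu> U B
  proof -
    have "emeasure \<mu> B \<le> emeasure \<mu> U"
      using that by (intro emeasure_mono) (auto simp: invariant_prob_measure_def)
    with that(4) show ?thesis by (rule order_less_le_trans)
  qed
  \<comment> \<open>Recurrence is applied to a \<open>\<tau>\<close>-compact neighbourhood \<open>K\<close> of \<open>x\<close> inside \<open>U\<close>: the open set
    \<open>U\<close> itself could lose all its mass when passing from the mean to a measure.\<close>
  have near_recurrent: "\<exists>\<mu>. invariant_prob_measure T \<mu> \<and> emeasure \<mu> U > 0 \<and>
      emeasure \<mu> (- (\<tau> closure_of forward_orbit T x)) = 0"
    if rec: "reiteratively_recurrent_point T x" and U: "open U" "x \<in> U" for x U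
  proof -
    obtain V K where K: "open V" "compactin \<tau> K" "x \<in> V" "V \<subseteq> K" "K \<subseteq> U"
      using assms(6) U unfolding neighbourhood_base_of by (metis open_openin)
    then have "x \<in> interior K" by (auto dest: interior_maximal)
    then obtain m where m: "shift_invariant_mean m" "m (visit_times T x K) > 0"
      using rec upper_Banach_density_pos_imp_mean unfolding reiteratively_recurrent_point_def by blast
    obtain \<mu> where \<mu>: "invariant_prob_measure T \<mu>" "emeasure \<mu> K > 0"
        "emeasure \<mu> (- (\<tau> closure_of forward_orbit T x)) = 0"
      using invariant_measure_from_mean[OF assms(1-4) borel m(1) K(2) m(2)] by blast
    have "emeasure \<mu> U > 0"
      using \<mu>(1) U(1) K(5) \<mu>(2) by (rule pos_mono)
    with \<mu> show ?thesis by blast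
  qed
  obtain \<B> :: "'a set set" where \<B>: "countable \<B>" "topological_basis \<B>"
    using ex_countable_basis by blast
  have \<B>_open: "open B" if "B \<in> \<B>" for B
    using \<B>(2) that by (rule topological_basis_open)
  have \<B>_nbhd: "\<exists>B\<in>\<B>. x \<in> B \<and> B \<subseteq> U" if "open U" "x \<in> U" for x U
    using topological_basisE[OF \<B>(2) that] by metis
  show ?thesis
  proof (intro conjI allI impI)
    fix x assume rec: "reiteratively_recurrent_point T x"
    let ?C = "\<tau> closure_of forward_orbit T x"
    have "openin \<tau> (- ?C)"
      using closedin_closure_of[of \<tau> "forward_orbit T x"] assms(2)
      by (simp add: closedin_def Compl_eq_Diff_UNIV)
    then have C: "open (- ?C)" by (rule assms(5))
    have "\<exists>\<mu>. invariant_prob_measure T \<mu> \<and> (\<forall>B\<in>{B \<in> \<B>. x \<in> B}. emeasure \<mu> B > 0) \<and>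
        emeasure \<mu> (- ?C) = 0"
    proof (rule countable_mixture_of_invariant_measures[OF assms(1)])
      show "countable {B \<in> \<B>. x \<in> B}" using \<B>(1) by simp
      show "{B \<in> \<B>. x \<in> B} \<noteq> {}" using \<B>_nbhd[of UNIV x] by auto
      show "- ?C \<in> sets borel" using C by (rule borel_open)
    next
      fix B assume "B \<in> {B \<in> \<B>. x \<in> B}"
      then have B: "open B" "x \<in> B" using \<B>_open by auto
      then show "B \<in> sets borel" by simp
      show "\<exists>\<mu>. invariant_prob_measure T \<mu> \<and> emeasure \<mu> B > 0 \<and> emeasure \<mu> (- ?C) = 0"
        using rec B by (rule near_recurrent)
    qed
    then obtain \<mu> where \<mu>: "invariant_prob_measure T \<mu>"
        "\<And>B. B \<in> \<B> \<Longrightarrow> x \<in> B \<Longrightarrow> emeasure \<mu> B > 0" "emeasure \<mu> (- ?C) = 0"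
      by blast
    have "x \<in> measure_support \<mu>"
      unfolding measure_support_def
    proof clarify
      fix U assume "x \<in> U" "open U" and null: "emeasure \<mu> U = 0"
      then obtain B where "B \<in> \<B>" "x \<in> B" "B \<subseteq> U" using \<B>_nbhd by blast
      then have "emeasure \<mu> U > 0"
        using pos_mono[OF \<mu>(1) \<open>open U\<close>] \<mu>(2) by blast
      with null show False by simp
    qed
    moreover have "measure_support \<mu> \<subseteq> ?C"
      using C \<mu>(3) unfolding measure_support_def by blast
    ultimately show "\<exists>\<mu>. invariant_prob_measure T \<mu> \<and> x \<in> measure_support \<mu> \<and> measure_support \<mu> \<subseteq> ?C"
      using \<mu>(1) by blast
  next
    assume dense: "reiteratively_recurrent T"
    have charging: "\<exists>\<mu>. invariant_prob_measure T \<mu> \<and> emeasure \<mu> B > 0 \<and> emeasure \<mu> {} = 0"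
      if B: "open B" "B \<noteq> {}" for B
    proof -
      have "B \<inter> closure {x. reiteratively_recurrent_point T x} \<noteq> {}"
        using dense B by (simp add: reiteratively_recurrent_def)
      then obtain x where "x \<in> B" "reiteratively_recurrent_point T x"
        using open_Int_closure_eq_empty[OF B(1)] by blast
      from near_recurrent[OF this(2) B(1) this(1)] show ?thesis by auto
    qed
    have "\<exists>\<mu>. invariant_prob_measure T \<mu> \<and> (\<forall>B\<in>\<B> - {{}}. emeasure \<mu> B > 0) \<and> emeasure \<mu> {} = 0"
    proof (rule countable_mixture_of_invariant_measures[OF assms(1)])
      show "countable (\<B> - {{}})" using \<B>(1) by simp
      show "\<B> - {{}} \<noteq> {}" using \<B>_nbhd[of UNIV undefined] by blast
    next
      fix B assume "B \<in> \<B> - {{}}"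
      then have B: "open B" "B \<noteq> {}" using \<B>_open by auto
      then show "B \<in> sets borel" by simp
      show "\<exists>\<mu>. invariant_prob_measure T \<mu> \<and> emeasure \<mu> B > 0 \<and> emeasure \<mu> {} = 0"
        using B by (rule charging)
    qed simp
    then obtain \<mu> where \<mu>: "invariant_prob_measure T \<mu>" "\<And>B. B \<in> \<B> \<Longrightarrow> B \<noteq> {} \<Longrightarrow> emeasure \<mu> B > 0"
      by blast
    have "full_support \<mu>"
      unfolding full_support_def
    proof clarify
      fix U :: "'a set" assume "open U" "U \<noteq> {}"
      then obtain x B where "B \<in> \<B>" "x \<in> B" "B \<subseteq> U" using \<B>_nbhd by blast
      then show "emeasure \<mu> U > 0"
        using pos_mono[OF \<mu>(1) \<open>open U\<close>] \<mu>(2) by blast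
    qed
    with \<mu>(1) show "\<exists>\<mu>. invariant_prob_measure T \<mu> \<and> full_support \<mu>" by blast
  qed
qed

end
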